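(* Let $\Gamma$ be a distance-regular graph with diameter $D\ge 3$, and fix a vertex $x$. With all notation as in the context, the following hold. (1) $M\cap M^*$ has orthogonal basis $\{I\}$ and dimension $1$. (2) $M$ has orthogonal basis $\{A_i\}_{i=0}^D$ and dimension $D+1$. (3) $M^*$ has orthogonal basis $\{A_i^*\}_{i=0}^D$ and dimension $D+1$. (4) $M+M^*$ has orthogonal basis $\{A_D,\dots,A_1,I,A_1^*,\dots,A_D^*\}$ and dimension $2D+1$. (5) $MM^*\cap M^*M$ has orthogonal basis $\{A_iA_j^*\mid 0\le i,j\le D,\ u_i(\theta_j)=\pm1\}$ and dimension $2D+1+P$. (6) $MM^*$ has orthogonal basis $\{A_iA_j^*\mid 0\le i,j\le D\}$ and dimension $(D+1)^2$. (7) $M^*M$ has orthogonal basis $\{A_j^*A_i\mid 0\le i,j\le D\}$ and dimension $(D+1)^2$. (8) $MM^*+M^*M$ has orthogonal basis $\{A_iA_j^*+A_j^*A_i,\ A_iA_j^*-A_j^*A_i\mid 0\le i,j\le D,\ u_i(\theta_j)\ne\pm1\}\cup\{A_iA_j^*\mid 0\le i,j\le D,\ u_i(\theta_j)=\pm1\}$ and dimension $2D^2+2D+1-P$.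
   Context: Let $\Gamma=(X,\mathcal E)$ be a finite, undirected, connected graph without loops or multiple edges, with shortest-path distance $\partial$ and diameter $D\ge3$. $\Gamma$ is distance-regular: for all $0\le h,i,j\le D$ and $y,z\in X$ with $\partial(y,z)=h$, the number $p^h_{ij}=|\{w\in X:\partial(y,w)=i,\ \partial(z,w)=j\}|$ depends only on $h,i,j$. Write $k_i=p^0_{ii}$, $k=k_1$, $c_i=p^i_{1,i-1}$, $a_i=p^i_{1,i}$, $b_i=p^i_{1,i+1}$. Let $\mathrm{Mat}_X(\mathbb C)$ be the algebra of complex matrices with rows and columns indexed by $X$, with Hermitian inner product $\langle R,S\rangle=\mathrm{tr}(R^t\overline S)$. For $0\le i\le D$, $A_i$ is the $i$-th distance matrix ($(A_i)_{yz}=1$ if $\partial(y,z)=i$, else $0$); $A=A_1$, $A_0=I$. $M$ (the Bose–Mesner algebra) is the span of $A_0,\dots,A_D$. Let $E_0,\dots,E_D$ be the primitive idempotents of $M$ (a basis of $M$ with $E_0=|X|^{-1}J$, $\sum_iE_i=I$, $E_iE_j=\delta_{ij}E_i$, each $E_i$ real symmetric), $m_i=\mathrm{rank}(E_i)$, and $\theta_i$ the eigenvalue of $A$ with $AE_i=\theta_iE_i$. Define polynomials $u_0,\dots,u_D\in\mathbb C[\lambda]$ by $u_0=1$, $u_1=\lambda/k$, $\lambda u_i=c_iu_{i-1}+a_iu_i+b_iu_{i+1}$ for $1\le i\le D-1$. Fix a vertex $x\in X$. For $0\le i\le D$, $E_i^*$ is the diagonal matrix with $(y,y)$-entry $1$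 if $\partial(x,y)=i$ and $0$ otherwise; $M^*$ (the dual Bose–Mesner algebra) is the span of $E_0^*,\dots,E_D^*$. $A_i^*$ is the diagonal matrix with $(A_i^* )_{yy}=|X|(E_i)_{xy}$; $A_0^*=I$. For subspaces $\mathcal R,\mathcal S$, $\mathcal R\mathcal S=\mathrm{Span}\{RS: R\in\mathcal R, S\in\mathcal S\}$. Define $P=|\{(i,j):1\le i,j\le D,\ u_i(\theta_j)=\pm1\}|$. *)

theory Defs
  imports "HOL-Analysis.Analysis" "HOL-Computational_Algebra.Polynomial"
begin

section \<open>Distance-regular graphs\<close>

text \<open>
  The vertex set \<open>X\<close> is the universe of a finite type, and a simple graph on it is a
  symmetric irreflexive adjacency relation.
\<close>

definition gdist :: "('v \<Rightarrow> 'v \<Rightarrow> bool) \<Rightarrow> 'v \<Rightarrow> 'v \<Rightarrow> nat" where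
  "gdist adj y z = (LEAST n. (adj ^^ n) y z)"

definition gdiam :: "('v::finite \<Rightarrow> 'v \<Rightarrow> bool) \<Rightarrow> nat" where
  "gdiam adj = Max {gdist adj y z |y z. True}"

definition distance_regular :: "('v::finite \<Rightarrow> 'v \<Rightarrow> bool) \<Rightarrow> bool" where
  "distance_regular adj \<longleftrightarrow>
     (\<forall>h\<le>gdiam adj. \<forall>i\<le>gdiam adj. \<forall>j\<le>gdiam adj. \<exists>n. \<forall>y z. gdist adj y z = h \<longrightarrow>
        card {w. gdist adj y w = i \<and> gdist adj z w = j} = n)"

definition inter_num :: "('v::finite \<Rightarrow> 'v \<Rightarrow> bool) \<Rightarrow> nat \<Rightarrow> nat \<Rightarrow> nat \<Rightarrow> nat" where
  "inter_num adj h i j =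
     (THE n. \<forall>y z. gdist adj y z = h \<longrightarrow> card {w. gdist adj y w = i \<and> gdist adj z w = j} = n)"

definition k_val :: "('v::finite \<Rightarrow> 'v \<Rightarrow> bool) \<Rightarrow> nat" where
  "k_val adj = inter_num adj 0 1 1"

definition c_num :: "('v::finite \<Rightarrow> 'v \<Rightarrow> bool) \<Rightarrow> nat \<Rightarrow> nat" where
  "c_num adj i = inter_num adj i 1 (i - 1)"

definition a_num :: "('v::finite \<Rightarrow> 'v \<Rightarrow> bool) \<Rightarrow> nat \<Rightarrow> nat" where
  "a_num adj i = inter_num adj i 1 i"

definition b_num :: "('v::finite \<Rightarrow> 'v \<Rightarrow> bool) \<Rightarrow> nat \<Rightarrow> nat" where
  "b_num adj i = inter_num adj i 1 (i + 1)"

text \<open>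
  The three-term recurrence solved for its leading term; \<open>b_num adj i\<close> is nonzero for
  \<open>i < gdiam adj\<close> (lemma \<open>u_poly_recurrence\<close> below restates the recurrence).
  Only the values \<open>u_poly adj i\<close> with \<open>i \<le> gdiam adj\<close> are meaningful.
\<close>

fun u_poly :: "('v::finite \<Rightarrow> 'v \<Rightarrow> bool) \<Rightarrow> nat \<Rightarrow> complex poly" where
  "u_poly adj 0 = 1"
| "u_poly adj (Suc 0) = [:0, 1 / of_nat (k_val adj):]"
| "u_poly adj (Suc (Suc i)) =
     smult (1 / of_nat (b_num adj (Suc i)))
       ([:0, 1:] * u_poly adj (Suc i)
         - smult (of_nat (c_num adj (Suc i))) (u_poly adj i)
         - smult (of_nat (a_num adj (Suc i))) (u_poly adj (Suc i)))"


section \<open>Complex matrices indexed by the vertices\<close>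

text \<open>
  The library only equips \<open>complex^'v^'v\<close> with its real vector space structure, so the
  complex one is introduced here.
\<close>

definition cscale :: "complex \<Rightarrow> complex^'v^'v \<Rightarrow> complex^'v^'v" where
  "cscale c R = map_matrix (\<lambda>t. c * t) R"

global_interpretation cmat: vector_space "cscale :: complex \<Rightarrow> complex^'v^'v \<Rightarrow> complex^'v^'v"
  by unfold_locales (simp_all add: cscale_def vec_eq_iff algebra_simps)

definition herm_inner :: "complex^'v^'v \<Rightarrow> complex^'v^'v \<Rightarrow> complex" where
  "herm_inner R S = trace (transpose R ** map_matrix cnj S)"

definition orthogonal_basis :: "(complex^'v^'v) set \<Rightarrow> (complex^'v^'v) set \<Rightarrow> bool" where
  "orthogonal_basis B V \<longleftrightarrow>
     cmat.independent B \<and> cmat.span B = V \<and> pairwise (\<lambda>R S. herm_inner R S = 0) B"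

definition space_prod :: "(complex^'v^'v) set \<Rightarrow> (complex^'v^'v) set \<Rightarrow> (complex^'v^'v) set" where
  "space_prod V W = cmat.span {R ** S |R S. R \<in> V \<and> S \<in> W}"


section \<open>The Bose--Mesner algebra and its dual\<close>

definition dist_mat :: "('v::finite \<Rightarrow> 'v \<Rightarrow> bool) \<Rightarrow> nat \<Rightarrow> complex^'v^'v" where
  "dist_mat adj i = (\<chi> y z. if gdist adj y z = i then 1 else 0)"

definition bose_mesner :: "('v::finite \<Rightarrow> 'v \<Rightarrow> bool) \<Rightarrow> (complex^'v^'v) set" where
  "bose_mesner adj = cmat.span (dist_mat adj ` {0..gdiam adj})"

definition primitive_idempotents ::
    "('v::finite \<Rightarrow> 'v \<Rightarrow> bool) \<Rightarrow> (nat \<Rightarrow> complex^'v^'v) \<Rightarrow> bool" where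
  "primitive_idempotents adj E \<longleftrightarrow>
     inj_on E {0..gdiam adj} \<and>
     cmat.independent (E ` {0..gdiam adj}) \<and>
     cmat.span (E ` {0..gdiam adj}) = bose_mesner adj \<and>
     E 0 = (\<chi> y z. 1 / of_nat CARD('v)) \<and>
     (\<Sum>i=0..gdiam adj. E i) = mat 1 \<and>
     (\<forall>i\<le>gdiam adj. \<forall>j\<le>gdiam adj. E i ** E j = (if i = j then E i else 0)) \<and>
     (\<forall>i\<le>gdiam adj. map_matrix cnj (E i) = E i \<and> transpose (E i) = E i)"

definition dual_idem :: "('v::finite \<Rightarrow> 'v \<Rightarrow> bool) \<Rightarrow> 'v \<Rightarrow> nat \<Rightarrow> complex^'v^'v" where
  "dual_idem adj x i = (\<chi> y z. if y = z \<and> gdist adj x y = i then 1 else 0)"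

definition dual_bose_mesner :: "('v::finite \<Rightarrow> 'v \<Rightarrow> bool) \<Rightarrow> 'v \<Rightarrow> (complex^'v^'v) set" where
  "dual_bose_mesner adj x = cmat.span (dual_idem adj x ` {0..gdiam adj})"

definition dual_dist_mat ::
    "(nat \<Rightarrow> complex^'v^'v) \<Rightarrow> 'v::finite \<Rightarrow> nat \<Rightarrow> complex^'v^'v" where
  "dual_dist_mat E x i = (\<chi> y z. if y = z then of_nat CARD('v) * E i $ x $ y else 0)"

definition P_count :: "('v::finite \<Rightarrow> 'v \<Rightarrow> bool) \<Rightarrow> (nat \<Rightarrow> complex) \<Rightarrow> nat" where
  "P_count adj \<theta> =
     card {(i, j). i \<in> {1..gdiam adj} \<and> j \<in> {1..gdiam adj} \<and> poly (u_poly adj i) (\<theta> j) \<in> {1, -1}}"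


section \<open>The recurrence of the polynomials\<close>

lemma gdist_le: "(adj ^^ n) y z \<Longrightarrow> gdist adj y z \<le> n"
  unfolding gdist_def by (rule Least_le)

lemma gdist_walk:
  assumes "\<forall>y z. adj\<^sup>*\<^sup>* y z"
  shows "(adj ^^ gdist adj y z) y z"
proof -
  obtain n where "(adj ^^ n) y z"
    using assms rtranclp_imp_relpowp by metis
  then show ?thesis
    unfolding gdist_def by (rule LeastI)
qed

lemma relpowp_sym:
  assumes "symp adj" "(adj ^^ n) y z"
  shows "(adj ^^ n) z y"
  using assms(2)
proof (induction n arbitrary: z)
  case 0
  then show ?case by simp
next
  case (Suc n)
  then obtain w where "(adj ^^ n) y w" "adj w z" by auto
  then have "adj z w" "(adj ^^ n) w y"
    using Suc.IH assms(1) by (auto dest: sympD)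
  then show ?case by (rule relpowp_Suc_I2)
qed

lemma gdist_sym: "symp adj \<Longrightarrow> gdist adj y z = gdist adj z y"
  unfolding gdist_def by (metis relpowp_sym)

lemma gdist_triangle:
  assumes "\<forall>y z. adj\<^sup>*\<^sup>* y z"
  shows "gdist adj y z \<le> gdist adj y w + gdist adj w z"
proof -
  have "(adj ^^ (gdist adj y w + gdist adj w z)) y z"
    unfolding relpowp_add using gdist_walk[OF assms] by blast
  then show ?thesis by (rule gdist_le)
qed

lemma inter_num_eq:
  assumes "distance_regular adj" "i \<le> gdiam adj" "j \<le> gdiam adj"
    and "gdist adj y z \<le> gdiam adj"
  shows "inter_num adj (gdist adj y z) i j = card {w. gdist adj y w = i \<and> gdist adj z w = j}"
proof -
  obtain n where n: "\<forall>y' z'. gdist adj y' z' = gdist adj y z \<longrightarrow>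
      card {w. gdist adj y' w = i \<and> gdist adj z' w = j} = n"
    using assms unfolding distance_regular_def by blast
  then have "inter_num adj (gdist adj y z) i j = n"
    unfolding inter_num_def by (intro the_equality) auto
  with n show ?thesis by auto
qed

lemma b_num_nonzero:
  fixes adj :: "'v::finite \<Rightarrow> 'v \<Rightarrow> bool"
  assumes sym: "symp adj" and irr: "irreflp adj" and con: "\<forall>y z. adj\<^sup>*\<^sup>* y z"
    and dr: "distance_regular adj" and i: "i < gdiam adj"
  shows "b_num adj i \<noteq> 0"
proof -
  have fin: "finite {gdist adj y z |y z. True}"
    by (rule finite_subset[of _ "range (\<lambda>(y, z). gdist adj y z)"]) auto
  have "gdiam adj \<in> {gdist adj y z |y z. True}"
    unfolding gdiam_def using fin by (intro Max_in) auto
  then obtain y z where yz: "gdist adj y z = gdiam adj" by auto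
  have "(adj ^^ (Suc i + (gdiam adj - Suc i))) y z"
    using gdist_walk[OF con, of y z] yz i by simp
  then obtain v where v: "(adj ^^ Suc i) y v" "(adj ^^ (gdiam adj - Suc i)) v z"
    unfolding relpowp_add by blast
  then obtain u where u: "(adj ^^ i) y u" "adj u v" by auto
  have uv1: "(adj ^^ 1) u v" using u(2) by auto
  have "u \<noteq> v" using irr u(2) by (auto dest: irreflpD)
  then have "gdist adj u v \<noteq> 0" using gdist_walk[OF con, of u v] by (metis relpowp.simps(1))
  then have uv: "gdist adj u v = 1" using gdist_le[OF uv1] by simp
  have yv: "gdist adj y v = Suc i"
    using gdist_triangle[OF con, of y z v] gdist_le[OF v(1)] gdist_le[OF v(2)] yz i by linarith
  have yu: "gdist adj y u = i"
    using gdist_triangle[OF con, of y v u] gdist_le[OF u(1)] uv yv by linarith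
  have "b_num adj i = card {w. gdist adj u w = 1 \<and> gdist adj y w = i + 1}"
    unfolding b_num_def using inter_num_eq[OF dr, of 1 "i + 1" u y] yu i gdist_sym[OF sym, of y u]
    by simp
  moreover have "v \<in> {w. gdist adj u w = 1 \<and> gdist adj y w = i + 1}"
    using uv yv by simp
  ultimately show ?thesis by (metis card_eq_0_iff empty_iff finite)
qed

lemma u_poly_recurrence:
  fixes adj :: "'v::finite \<Rightarrow> 'v \<Rightarrow> bool"
  assumes "symp adj" "irreflp adj" "\<forall>y z. adj\<^sup>*\<^sup>* y z" "distance_regular adj"
    and "1 \<le> i" "i \<le> gdiam adj - 1"
  shows "[:0, 1:] * u_poly adj i =
           smult (of_nat (c_num adj i)) (u_poly adj (i - 1))
         + smult (of_nat (a_num adj i)) (u_poly adj i)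
         + smult (of_nat (b_num adj i)) (u_poly adj (i + 1))"
proof -
  obtain j where j: "i = Suc j" using assms(5) by (cases i) auto
  have "b_num adj i \<noteq> 0"
    using b_num_nonzero[OF assms(1-4)] assms(5,6) by simp
  then show ?thesis unfolding j by simp
qed

end

theory Submission
  imports Defs
begin

text \<open>
  For \<open>i, j \<le> D\<close> the matrices \<open>A\<^sub>i A\<^sup>*\<^sub>j\<close> and \<open>A\<^sup>*\<^sub>j A\<^sub>i\<close> both have squared norm
  \<open>N = |X|\<^sup>2 k\<^sub>i (E\<^sub>j)\<^sub>x\<^sub>x > 0\<close>, their mutual inner product is \<open>u\<^sub>i(\<theta>\<^sub>j) N\<close>, and matrices of this
  kind with different indices are orthogonal. So \<open>MM\<^sup>* + M\<^sup>*M\<close> is the orthogonal sum of the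
  spaces spanned by these pairs, and the pair \<open>(i, j)\<close> is linearly dependent exactly if
  \<open>u\<^sub>i(\<theta>\<^sub>j) = \<plusminus>1\<close>, which always happens for \<open>i = 0\<close> or \<open>j = 0\<close>. Since \<open>A\<^sub>i = A\<^sub>i A\<^sup>*\<^sub>0\<close> and
  \<open>A\<^sup>*\<^sub>j = A\<^sub>0 A\<^sup>*\<^sub>j\<close>, the bases of the smaller spaces are subfamilies.
\<close>

section \<open>The Hermitian inner product\<close>

lemma herm_inner_sum: "herm_inner R S = (\<Sum>y\<in>UNIV. \<Sum>z\<in>UNIV. R $ y $ z * cnj (S $ y $ z))"
proof -
  have "herm_inner R S = (\<Sum>z\<in>UNIV. \<Sum>y\<in>UNIV. R $ y $ z * cnj (S $ y $ z))"
    by (simp add: herm_inner_def trace_def matrix_matrix_mult_def transpose_def)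
  then show ?thesis by (subst sum.swap)
qed

lemma cscale_nth [simp]: "cscale c R $ y $ z = c * R $ y $ z"
  by (simp add: cscale_def)

lemma herm_inner_add_left: "herm_inner (R + S) T = herm_inner R T + herm_inner S T"
  by (simp add: herm_inner_sum sum.distrib algebra_simps)

lemma herm_inner_add_right: "herm_inner T (R + S) = herm_inner T R + herm_inner T S"
  by (simp add: herm_inner_sum sum.distrib algebra_simps)

lemma herm_inner_diff_left: "herm_inner (R - S) T = herm_inner R T - herm_inner S T"
  by (simp add: herm_inner_sum sum_subtractf algebra_simps)

lemma herm_inner_diff_right: "herm_inner T (R - S) = herm_inner T R - herm_inner T S"
  by (simp add: herm_inner_sum sum_subtractf algebra_simps)

lemma herm_inner_scale_left: "herm_inner (cscale c R) T = c * herm_inner R T"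
  by (simp add: herm_inner_sum sum_distrib_left algebra_simps)

lemma herm_inner_scale_right: "herm_inner T (cscale c R) = cnj c * herm_inner T R"
  by (simp add: herm_inner_sum sum_distrib_left algebra_simps)

lemma herm_inner_zero_left [simp]: "herm_inner 0 T = 0"
  by (simp add: herm_inner_sum)

lemma herm_inner_sum_left: "herm_inner (\<Sum>i\<in>I. f i) T = (\<Sum>i\<in>I. herm_inner (f i) T)"
  by (induction I rule: infinite_finite_induct) (simp_all add: herm_inner_add_left)

lemma herm_inner_commute: "herm_inner S R = cnj (herm_inner R S)"
  by (simp add: herm_inner_sum mult.commute)

lemma herm_inner_transpose: "herm_inner (transpose R) (transpose S) = herm_inner R (S :: complex^'v::finite^'v)"
  unfolding herm_inner_sum transpose_def by (simp, subst sum.swap, simp)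

lemma herm_inner_self_eq_0:
  fixes R :: "complex^'v::finite^'v"
  assumes "herm_inner R R = 0"
  shows "R = 0"
proof -
  have "herm_inner R R = of_real (\<Sum>y\<in>UNIV. \<Sum>z\<in>UNIV. (cmod (R $ y $ z))\<^sup>2)"
    unfolding herm_inner_sum of_real_sum complex_norm_square ..
  then have "(\<Sum>y\<in>UNIV. \<Sum>z\<in>UNIV. (cmod (R $ y $ z))\<^sup>2) = 0"
    using assms by (metis of_real_eq_0_iff)
  then have "\<forall>y z. R $ y $ z = 0"
    by (simp add: sum_nonneg_eq_0_iff sum_nonneg)
  then show ?thesis by (simp add: vec_eq_iff)
qed

lemma orthogonal_independent:
  assumes fin: "finite B" and orth: "pairwise (\<lambda>R S. herm_inner R S = 0) B"
    and nz: "\<And>R. R \<in> B \<Longrightarrow> herm_inner R R \<noteq> 0"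
  shows "cmat.independent B"
proof (rule cmat.independent_if_scalars_zero[OF fin])
  fix c S assume 0: "(\<Sum>R\<in>B. cscale (c R) R) = 0" and S: "S \<in> B"
  have "0 = herm_inner (\<Sum>R\<in>B. cscale (c R) R) S"
    using 0 by simp
  also have "\<dots> = (\<Sum>R\<in>B. c R * herm_inner R S)"
    by (simp add: herm_inner_sum_left herm_inner_scale_left)
  also have "\<dots> = (\<Sum>R\<in>B. if R = S then c S * herm_inner S S else 0)"
    using orth S by (intro sum.cong) (auto simp: pairwise_def)
  finally have "c S * herm_inner S S = 0"
    using fin S by simp
  then show "c S = 0" using nz[OF S] by simp
qed

text \<open>The diagonal Gram matrix with nonzero diagonal also makes \<open>f\<close> injective on
  \<open>I\<close>: \<open>f p = f q\<close> with \<open>p \<noteq> q\<close> would force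
  \<open>N p = 0\<close>. Hence the dimension counts indices, not merely distinct matrices.\<close>

lemma orthogonal_family_basis:
  fixes f :: "'i \<Rightarrow> complex^'v::finite^'v"
  assumes "finite I"
    and "\<And>p q. p \<in> I \<Longrightarrow> q \<in> I \<Longrightarrow> herm_inner (f p) (f q) = (if p = q then N p else 0)"
    and "\<And>p. p \<in> I \<Longrightarrow> N p \<noteq> 0"
  shows "orthogonal_basis (f ` I) (cmat.span (f ` I))"
    and "cmat.dim (cmat.span (f ` I)) = card I"
proof -
  have inj: "inj_on f I"
    using assms(2,3) by (metis inj_onI)
  have orth: "pairwise (\<lambda>R S. herm_inner R S = 0) (f ` I)"
    using assms(2) by (auto simp: pairwise_def)
  have ind: "cmat.independent (f ` I)"
    using orth assms by (intro orthogonal_independent) auto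
  show "orthogonal_basis (f ` I) (cmat.span (f ` I))"
    using ind orth by (simp add: orthogonal_basis_def)
  show "cmat.dim (cmat.span (f ` I)) = card I"
    using ind inj by (simp add: cmat.dim_span cmat.dim_eq_card_independent card_image)
qed

lemma span_family_expansion:
  assumes "finite I" and "R \<in> cmat.span (f ` I)"
  obtains a where "R = (\<Sum>p\<in>I. cscale (a p) (f p))"
proof -
  have "\<exists>a. R = (\<Sum>p\<in>I. cscale (a p) (f p))"
    using assms(2)
  proof (induction rule: cmat.span_induct_alt)
    case base
    show ?case by (rule exI[of _ "\<lambda>_. 0"]) simp
  next
    case (step c S T)
    then obtain a p where a: "T = (\<Sum>p\<in>I. cscale (a p) (f p))" and p: "p \<in> I" "S = f p"
      by auto
    \<comment> \<open>The coefficient at one chosen preimage \<open>p\<close> of \<open>S\<close> is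
      raised by \<open>c\<close>, so \<open>f\<close> may take the same value at several
      indices.\<close>
    have "cscale c S + T = (\<Sum>q\<in>I. cscale (if q = p then c else 0) (f q) + cscale (a q) (f q))"
      using p assms(1) a by (simp add: sum.distrib if_distrib[of "\<lambda>t. cscale t _"] cong: if_cong)
    then show ?case
      by (intro exI[of _ "\<lambda>q. (if q = p then c else 0) + a q"]) (simp add: cmat.scale_left_distrib)
  qed
  then show thesis using that by blast
qed

text \<open>Reads off one coefficient. \<open>T\<close> may be the \<open>p\<close>-th member of
  either family, so \<open>L p\<close> can be a squared norm or a mixed inner product.\<close>

lemma herm_inner_expansion:
  assumes "finite I" and "p \<in> I"
    and "\<And>q. q \<in> I \<Longrightarrow> herm_inner (h q) T = (if q = p then L p else 0)"
  shows "herm_inner (\<Sum>q\<in>I. cscale (a q) (h q)) T = a p * L p"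
proof -
  have "herm_inner (\<Sum>q\<in>I. cscale (a q) (h q)) T = (\<Sum>q\<in>I. if q = p then a p * L p else 0)"
    unfolding herm_inner_sum_left herm_inner_scale_left
    by (rule sum.cong) (auto simp: assms(3))
  then show ?thesis using assms by simp
qed

section \<open>Two orthogonal families coupled index by index\<close>

text \<open>The two members at \<open>p\<close> have the same squared norm \<open>N p\<close>, so
  \<open>c p\<close> is the cosine of the angle between them. That \<open>gf\<close> has the same
  right-hand side as \<open>fg\<close> makes \<open>c p\<close> real.\<close>

locale coupled_families =
  fixes f g :: "'i \<Rightarrow> complex^'v::finite^'v" and I :: "'i set" and N c :: "'i \<Rightarrow> complex"
  assumes fin: "finite I"
    and ff: "\<And>p q. p \<in> I \<Longrightarrow> q \<in> I \<Longrightarrow> herm_inner (f p) (f q) = (if p = q then N p else 0)"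
    and gg: "\<And>p q. p \<in> I \<Longrightarrow> q \<in> I \<Longrightarrow> herm_inner (g p) (g q) = (if p = q then N p else 0)"
    and fg: "\<And>p q. p \<in> I \<Longrightarrow> q \<in> I \<Longrightarrow> herm_inner (f p) (g q) = (if p = q then c p * N p else 0)"
    and gf: "\<And>p q. p \<in> I \<Longrightarrow> q \<in> I \<Longrightarrow> herm_inner (g p) (f q) = (if p = q then c p * N p else 0)"
    and nz: "\<And>p. p \<in> I \<Longrightarrow> N p \<noteq> 0"
begin

abbreviation "dep \<equiv> {p \<in> I. c p \<in> {1, -1}}"
abbreviation "indep \<equiv> {p \<in> I. c p \<notin> {1, -1}}"

text \<open>Equality case of Cauchy-Schwarz: since \<open>c p\<close> is real, the squared norm of
  \<open>g p - cscale (c p) (f p)\<close> is \<open>N p * (1 - (c p)\<^sup>2)\<close>, which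
  vanishes here.\<close>

lemma parallel: "p \<in> dep \<Longrightarrow> g p = cscale (c p) (f p)"
proof -
  assume p: "p \<in> dep"
  have "herm_inner (g p - cscale (c p) (f p)) (g p - cscale (c p) (f p)) = 0"
    using p ff gg fg gf
    by (auto simp: herm_inner_diff_left herm_inner_diff_right herm_inner_scale_left
        herm_inner_scale_right)
  then show ?thesis using herm_inner_self_eq_0 by fastforce
qed

text \<open>If \<open>R\<close> has coefficients \<open>a\<close> in the first family and
  \<open>b\<close> in the second, pairing it with \<open>f p\<close> and \<open>g p\<close> gives
  \<open>a p = b p * c p\<close> and \<open>b p = a p * c p\<close>. So \<open>a p\<close> vanishes
  unless \<open>(c p)\<^sup>2 = 1\<close>.\<close>

lemma span_Int: "cmat.span (f ` I) \<inter> cmat.span (g ` I) = cmat.span (f ` dep)"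
proof (intro equalityI subsetI IntI)
  fix R assume "R \<in> cmat.span (f ` I) \<inter> cmat.span (g ` I)"
  then obtain a b where a: "R = (\<Sum>p\<in>I. cscale (a p) (f p))" and b: "R = (\<Sum>p\<in>I. cscale (b p) (g p))"
    using span_family_expansion[OF fin] by (metis IntE)
  have zero: "a p = 0" if p: "p \<in> I" "c p \<notin> {1, -1}" for p
  proof -
    have af: "herm_inner R (f p) = a p * N p"
      unfolding a using p fin by (intro herm_inner_expansion) (auto simp: ff)
    have ag: "herm_inner R (g p) = a p * (c p * N p)"
      unfolding a using p fin by (intro herm_inner_expansion) (auto simp: fg)
    have bf: "herm_inner R (f p) = b p * (c p * N p)"
      unfolding b using p fin by (intro herm_inner_expansion) (auto simp: gf)
    have bg: "herm_inner R (g p) = b p * N p"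
      unfolding b using p fin by (intro herm_inner_expansion) (auto simp: gg)
    have "a p = b p * c p" "b p = a p * c p"
      using af bf ag bg nz[OF p(1)] by auto
    then have "a p * (1 - (c p)\<^sup>2) = 0"
      by (simp add: power2_eq_square algebra_simps)
    moreover have "1 - (c p)\<^sup>2 \<noteq> 0"
      using p(2) by (auto simp: power2_eq_1_iff)
    ultimately show ?thesis by simp
  qed
  have "R = (\<Sum>p\<in>dep. cscale (a p) (f p))"
    unfolding a using zero fin by (intro sum.mono_neutral_right) auto
  then show "R \<in> cmat.span (f ` dep)"
    by (metis (no_types, lifting) cmat.span_sum cmat.span_scale cmat.span_base imageI)
next
  fix R assume R: "R \<in> cmat.span (f ` dep)"
  then show "R \<in> cmat.span (f ` I)"
    using cmat.span_mono[of "f ` dep" "f ` I"] by auto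
  have "f ` dep \<subseteq> cmat.span (g ` I)"
  proof (rule image_subsetI)
    fix p assume p: "p \<in> dep"
    \<comment> \<open>As \<open>c p\<close> is \<open>1\<close> or \<open>-1\<close>, it is its own
      inverse, and \<open>parallel\<close> can be solved for \<open>f p\<close>.\<close>
    then have "f p = cscale (c p) (g p)"
      using parallel[OF p] by auto
    then show "f p \<in> cmat.span (g ` I)"
      using p by (simp add: cmat.span_scale cmat.span_base)
  qed
  then show "R \<in> cmat.span (g ` I)"
    using R cmat.span_minimal[OF _ cmat.subspace_span] by blast
qed

text \<open>The second component is a tag: 0 for a sum, 1 for a difference, 2 for the one
  representative of a dependent pair. With all three kinds in one index set,
  \<open>orthogonal_family_basis\<close> also shows that no matrix occurs under two tags.\<close>

definition sum_index :: "('i \<times> nat) set" where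
  "sum_index = indep \<times> {0, 1} \<union> dep \<times> {2}"

definition sum_family :: "'i \<times> nat \<Rightarrow> complex^'v^'v" where
  "sum_family t = (if snd t = 0 then f (fst t) + g (fst t)
     else if snd t = 1 then f (fst t) - g (fst t) else f (fst t))"

lemma sum_family_image:
  "sum_family ` sum_index = (\<lambda>p. f p + g p) ` indep \<union> (\<lambda>p. f p - g p) ` indep \<union> f ` dep"
proof -
  have "sum_index = (\<lambda>p. (p, 0)) ` indep \<union> (\<lambda>p. (p, 1)) ` indep \<union> (\<lambda>p. (p, 2)) ` dep"
    by (auto simp: sum_index_def)
  then show ?thesis
    by (simp only: image_Un image_image) (auto simp: sum_family_def)
qed

text \<open>Half the sum and half the difference of \<open>f p + g p\<close> and
  \<open>f p - g p\<close> return \<open>f p\<close> and \<open>g p\<close>; for a dependent pair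
  \<open>g p\<close> is a multiple of \<open>f p\<close>.\<close>

lemma span_sum_family: "cmat.span (sum_family ` sum_index) = cmat.span (f ` I \<union> g ` I)"
proof (rule equalityI; rule cmat.span_minimal[OF _ cmat.subspace_span])
  show "sum_family ` sum_index \<subseteq> cmat.span (f ` I \<union> g ` I)"
    unfolding sum_family_image
    by (auto intro!: cmat.span_add cmat.span_diff intro: cmat.span_base)
  let ?S = "cmat.span (sum_family ` sum_index)"
  have "f p \<in> ?S \<and> g p \<in> ?S" if "p \<in> I" for p
  proof (cases "p \<in> dep")
    case True
    then have "f p \<in> ?S"
      unfolding sum_family_image by (intro cmat.span_base) auto
    then show ?thesis using parallel[OF True] by (simp add: cmat.span_scale)
  next
    case False
    with that have "f p + g p \<in> ?S" "f p - g p \<in> ?S"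
      unfolding sum_family_image by (auto intro!: cmat.span_base)
    then have *: "cscale (1/2) ((f p + g p) + (f p - g p)) \<in> ?S"
      "cscale (1/2) ((f p + g p) - (f p - g p)) \<in> ?S"
      by (blast intro: cmat.span_scale cmat.span_add cmat.span_diff)+
    have "cscale (1/2) ((f p + g p) + (f p - g p)) = f p"
      "cscale (1/2) ((f p + g p) - (f p - g p)) = g p"
      by (simp_all add: vec_eq_iff)
    with * show ?thesis by simp
  qed
  then show "f ` I \<union> g ` I \<subseteq> ?S" by auto
qed

text \<open>Sum and difference of a pair are orthogonal because both members have the same norm and
  their inner product is symmetric.\<close>

lemma sum_family_basis:
  shows "orthogonal_basis ((\<lambda>p. f p + g p) ` indep \<union> (\<lambda>p. f p - g p) ` indep \<union> f ` dep)
           (cmat.span (f ` I \<union> g ` I))"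
    and "cmat.dim (cmat.span (f ` I \<union> g ` I)) = 2 * card indep + card dep"
proof -
  \<comment> \<open>The squared norms: those of \<open>f p + g p\<close> and
    \<open>f p - g p\<close> are \<open>2 * N p * (1 + c p)\<close> and
    \<open>2 * N p * (1 - c p)\<close>, nonzero because \<open>c p\<close> is neither
    \<open>-1\<close> nor \<open>1\<close> on \<open>indep\<close>.\<close>
  define L where "L t = (if snd t = 0 then 2 * N (fst t) * (1 + c (fst t))
     else if snd t = 1 then 2 * N (fst t) * (1 - c (fst t)) else N (fst t))" for t :: "'i \<times> nat"
  have 1: "finite sum_index" using fin by (simp add: sum_index_def)
  have 2: "herm_inner (sum_family s) (sum_family t) = (if s = t then L s else 0)"
    if "s \<in> sum_index" "t \<in> sum_index" for s t
    using that unfolding sum_family_def sum_index_def L_def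
    by (cases s; cases t)
      (auto simp: herm_inner_add_left herm_inner_add_right herm_inner_diff_left
        herm_inner_diff_right ff fg gf gg algebra_simps)
  have 3: "L s \<noteq> 0" if "s \<in> sum_index" for s
  proof -
    have "1 + c (fst s) \<noteq> 0 \<and> 1 - c (fst s) \<noteq> 0" if "fst s \<in> indep"
      using that by (auto simp: add_eq_0_iff)
    then show ?thesis
      using that nz[of "fst s"] by (auto simp: L_def sum_index_def)
  qed
  note * = orthogonal_family_basis[of sum_index sum_family L, OF 1 2 3, unfolded span_sum_family]
  show "orthogonal_basis ((\<lambda>p. f p + g p) ` indep \<union> (\<lambda>p. f p - g p) ` indep \<union> f ` dep)
      (cmat.span (f ` I \<union> g ` I))"
    using *(1) unfolding sum_family_image .
  have "card sum_index = card (indep \<times> {0, 1::nat}) + card (dep \<times> {2::nat})"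
    unfolding sum_index_def using fin by (intro card_Un_disjoint) auto
  then show "cmat.dim (cmat.span (f ` I \<union> g ` I)) = 2 * card indep + card dep"
    using * by (simp add: card_cartesian_product)
qed

end

section \<open>Products and sums of spans\<close>

lemma mult_cscale_left: "cscale c R ** S = cscale c (R ** S)"
  by (simp add: vec_eq_iff matrix_matrix_mult_def sum_distrib_left mult.assoc)

lemma mult_cscale_right: "R ** cscale c S = cscale c (R ** S)"
  by (simp add: vec_eq_iff matrix_matrix_mult_def sum_distrib_left algebra_simps)

lemma matrix_add_rdistrib: "(R + S) ** T = R ** T + S ** (T :: complex^'v::finite^'v)"
  by (simp add: vec_eq_iff matrix_matrix_mult_def sum.distrib algebra_simps)

text \<open>Bilinearity, one factor at a time: \<open>left\<close> keeps the right factor a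
  generator, and the second induction then frees it.\<close>

lemma space_prod_span:
  "space_prod (cmat.span B) (cmat.span C) = cmat.span {R ** S |R S. R \<in> B \<and> S \<in> C}"
  (is "_ = ?V")
proof -
  have left: "R ** S \<in> ?V" if "R \<in> cmat.span B" "S \<in> C" for R S
    using that(1)
  proof (induction rule: cmat.span_induct_alt)
    case base
    show ?case using cmat.span_zero by simp
  next
    case (step c U T)
    have "cscale c (U ** S) + T ** S \<in> ?V"
      using step that(2) by (intro cmat.span_add cmat.span_scale) (auto intro!: cmat.span_base)
    then show ?case by (simp add: matrix_add_rdistrib mult_cscale_left)
  qed
  have "R ** S \<in> ?V" if R: "R \<in> cmat.span B" and "S \<in> cmat.span C" for R S
    using that(2)
  proof (induction rule: cmat.span_induct_alt)
    case base
    show ?case using cmat.span_zero by simp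
  next
    case (step c U T)
    have "cscale c (R ** U) + R ** T \<in> ?V"
      using step left[OF R] by (intro cmat.span_add cmat.span_scale) auto
    then show ?case by (simp add: matrix_add_ldistrib mult_cscale_right)
  qed
  then have "space_prod (cmat.span B) (cmat.span C) \<subseteq> ?V"
    unfolding space_prod_def by (intro cmat.span_minimal[OF _ cmat.subspace_span]) auto
  moreover have "?V \<subseteq> space_prod (cmat.span B) (cmat.span C)"
    unfolding space_prod_def by (intro cmat.span_mono) (auto intro: cmat.span_base)
  ultimately show ?thesis by blast
qed

lemma span_plus_span: "cmat.span B + cmat.span C = cmat.span (B \<union> C)"
  unfolding cmat.span_Un set_plus_def by auto

text \<open>This and the next three rewritings turn set comprehensions into images of sets of index
  pairs, the form in which the family lemmas apply.\<close>

lemma Setcompr_pair_image: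
  "{F i j |i j. i \<le> m \<and> j \<le> m \<and> Q i j}
     = (\<lambda>p. F (fst p) (snd p)) ` {p \<in> {0..m::nat} \<times> {0..m}. Q (fst p) (snd p)}"
  by force

lemma Setcompr_pair_image_all:
  "{F i j |i j. i \<le> m \<and> j \<le> m} = (\<lambda>p. F (fst p) (snd p)) ` ({0..m::nat} \<times> {0..m})"
  by force

lemma Setcompr_image2: "{F R S |R S. R \<in> a ` I \<and> S \<in> b ` J} = (\<lambda>p. F (a (fst p)) (b (snd p))) ` (I \<times> J)"
  by force

text \<open>The pair is exchanged so that \<open>As j ** A i\<close> is indexed by
  \<open>(i, j)\<close>, like its partner \<open>A i ** As j\<close>.\<close>

lemma Setcompr_image2_swap:
  "{F R S |R S. R \<in> a ` I \<and> S \<in> b ` J} = (\<lambda>p. F (a (snd p)) (b (fst p))) ` (J \<times> I)"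
  by force

section \<open>Bose--Mesner algebras of a distance-regular graph\<close>

locale drg =
  fixes adj :: "'v::finite \<Rightarrow> 'v \<Rightarrow> bool" and x :: 'v
    and E :: "nat \<Rightarrow> complex^'v^'v" and \<theta> :: "nat \<Rightarrow> complex"
  assumes sym: "symp adj" and irr: "irreflp adj" and con: "\<forall>y z. adj\<^sup>*\<^sup>* y z"
    and dr: "distance_regular adj" and diam_pos: "1 \<le> gdiam adj"
    and idem: "primitive_idempotents adj E"
    and eigen: "\<forall>i\<le>gdiam adj. dist_mat adj 1 ** E i = cscale (\<theta> i) (E i)"
begin

abbreviation "D \<equiv> gdiam adj"
abbreviation "d \<equiv> gdist adj"
abbreviation "A \<equiv> dist_mat adj"
abbreviation "As \<equiv> dual_dist_mat E x"

section \<open>Distances and spheres\<close>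

lemma d_commute: "d y z = d z y"
  using gdist_sym[OF sym] .

lemma d_eq_0: "d y z = 0 \<longleftrightarrow> y = z"
proof
  assume "d y z = 0"
  then show "y = z" using gdist_walk[OF con, of y z] by (metis relpowp.simps(1))
next
  assume "y = z"
  then show "d y z = 0" using gdist_le[where adj = adj and n = 0 and y = y and z = z] by simp
qed

lemma finite_dists: "finite {d y z |y z. True}"
  by (rule finite_subset[of _ "range (\<lambda>(y, z). d y z)"]) auto

lemma d_le: "d y z \<le> D"
  unfolding gdiam_def using finite_dists by (intro Max_ge) auto

text \<open>A shortest path between two vertices at distance \<open>D\<close> is cut after
  \<open>i\<close> steps; by the triangle inequality its initial piece is again shortest.\<close>

lemma ex_pair_at_distance:
  assumes "i \<le> D"
  obtains y z where "d y z = i"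
proof -
  have "D \<in> {d y z |y z. True}"
    unfolding gdiam_def using finite_dists by (intro Max_in) auto
  then obtain y z where yz: "d y z = D" by auto
  have "(adj ^^ (i + (D - i))) y z"
    using gdist_walk[OF con, of y z] yz assms by simp
  then obtain v where v: "(adj ^^ i) y v" "(adj ^^ (D - i)) v z"
    unfolding relpowp_add by blast
  have "d y v = i"
    using gdist_triangle[OF con, of y z v] gdist_le[OF v(1)] gdist_le[OF v(2)] yz assms by linarith
  then show thesis using that by blast
qed

definition valency :: "nat \<Rightarrow> nat" where
  "valency i = inter_num adj 0 i i"

lemma card_sphere: "i \<le> D \<Longrightarrow> card {w. d y w = i} = valency i"
  using inter_num_eq[OF dr, of i i y y] d_eq_0[of y y] by (simp add: valency_def)

lemma valency_nonzero: "i \<le> D \<Longrightarrow> valency i \<noteq> 0"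
proof -
  assume i: "i \<le> D"
  then obtain y z where "d y z = i" using ex_pair_at_distance by blast
  then have "z \<in> {w. d y w = i}" by simp
  then have "card {w. d y w = i} \<noteq> 0" by (metis card_eq_0_iff empty_iff finite)
  with card_sphere[OF i] show ?thesis by simp
qed

section \<open>Entries and eigenvalues of the primitive idempotents\<close>

lemma bose_mesner_entry_cong:
  assumes "R \<in> bose_mesner adj" and "d y z = d y' z'"
  shows "R $ y $ z = R $ y' $ z'"
  using assms(1) unfolding bose_mesner_def
  by (induction rule: cmat.span_induct_alt) (auto simp: dist_mat_def assms(2))

lemma E_in_bose_mesner: "j \<le> D \<Longrightarrow> E j \<in> bose_mesner adj"
proof -
  assume "j \<le> D"
  then have "E j \<in> cmat.span (E ` {0..D})" by (intro cmat.span_base) simp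
  then show ?thesis using idem by (simp add: primitive_idempotents_def)
qed

lemma E_cnj: "j \<le> D \<Longrightarrow> cnj (E j $ y $ z) = E j $ y $ z"
proof -
  assume "j \<le> D"
  then have "map_matrix cnj (E j) $ y $ z = E j $ y $ z"
    using idem by (simp add: primitive_idempotents_def)
  then show ?thesis by simp
qed

lemma E_commute: "j \<le> D \<Longrightarrow> E j $ y $ z = E j $ z $ y"
proof -
  assume "j \<le> D"
  then have "transpose (E j) $ z $ y = E j $ z $ y"
    using idem by (simp add: primitive_idempotents_def)
  then show ?thesis by (simp add: transpose_def)
qed

lemma E_mult: "i \<le> D \<Longrightarrow> j \<le> D \<Longrightarrow> E i ** E j = (if i = j then E i else 0)"
  using idem unfolding primitive_idempotents_def by simp

lemma E_nonzero: "j \<le> D \<Longrightarrow> E j \<noteq> 0"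
proof -
  assume "j \<le> D"
  then have "E j \<in> E ` {0..D}" by simp
  moreover have "cmat.independent (E ` {0..D})"
    using idem by (simp add: primitive_idempotents_def)
  ultimately show ?thesis using cmat.dependent_zero by metis
qed

text \<open>As \<open>E j\<close> is real, symmetric and idempotent, its diagonal entry at
  \<open>y\<close> is the sum of squares along row \<open>y\<close>. The diagonal is constant, so
  one zero on it would make every row vanish.\<close>

lemma E_diag_nonzero:
  assumes j: "j \<le> D"
  shows "E j $ x $ x \<noteq> 0"
proof
  assume 0: "E j $ x $ x = 0"
  have "E j $ y $ z = 0" for y z
  proof -
    have y0: "E j $ y $ y = 0"
      using bose_mesner_entry_cong[OF E_in_bose_mesner[OF j], of y y x x] 0 d_eq_0 by metis
    have "E j $ y $ y = (E j ** E j) $ y $ y"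
      using E_mult[OF j j] by simp
    also have "\<dots> = (\<Sum>w\<in>UNIV. E j $ y $ w * cnj (E j $ y $ w))"
      using E_commute[OF j] E_cnj[OF j] by (simp add: matrix_matrix_mult_def)
    also have "\<dots> = of_real (\<Sum>w\<in>UNIV. (cmod (E j $ y $ w))\<^sup>2)"
      unfolding of_real_sum complex_norm_square ..
    finally have "(\<Sum>w\<in>UNIV. (cmod (E j $ y $ w))\<^sup>2) = 0"
      using y0 by (metis of_real_eq_0_iff)
    then show ?thesis by (simp add: sum_nonneg_eq_0_iff)
  qed
  then have "E j = 0" by (simp add: vec_eq_iff)
  with E_nonzero[OF j] show False by simp
qed

lemma adjacency_eigen:
  assumes "j \<le> D"
  shows "(\<Sum>w | d y w = 1. E j $ w $ z) = \<theta> j * E j $ y $ z"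
proof -
  have "(\<Sum>w | d y w = 1. E j $ w $ z) = (\<Sum>w\<in>UNIV. A 1 $ y $ w * E j $ w $ z)"
    by (rule sum.mono_neutral_cong_left) (auto simp: dist_mat_def)
  also have "\<dots> = (A 1 ** E j) $ y $ z"
    by (simp add: matrix_matrix_mult_def)
  finally show ?thesis using eigen assms by simp
qed

text \<open>
  The entries of \<open>E j\<close> at distance \<open>i\<close> satisfy the recurrence of \<open>u_poly adj i\<close> at \<open>\<theta> j\<close>,
  obtained by reading off the entries of \<open>A 1 ** E j = cscale (\<theta> j) (E j)\<close>.
\<close>

lemma E_entry:
  assumes j: "j \<le> D"
  shows "E j $ y $ z = poly (u_poly adj (d y z)) (\<theta> j) * E j $ x $ x"
proof (induction "d y z" arbitrary: y z rule: less_induct)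
  case less
  note cong = bose_mesner_entry_cong[OF E_in_bose_mesner[OF j]]
  consider "d y z = 0" | "d y z = 1" | i where "d y z = Suc (Suc i)"
    by (metis One_nat_def not0_implies_Suc)
  then show ?case
  proof cases
    case 1
    then show ?thesis using cong[of y z x x] d_eq_0[of x x] by simp
  next
    case 2
    have k: "k_val adj = card {w. d x w = 1}"
      using card_sphere[of 1 x] diam_pos by (simp add: k_val_def valency_def)
    have k0: "k_val adj \<noteq> 0"
      using valency_nonzero[of 1] diam_pos by (simp add: k_val_def valency_def)
    \<comment> \<open>The eigenvalue equation is read at \<open>(x, x)\<close>: each of the
      \<open>k_val adj\<close> neighbours of \<open>x\<close> contributes the same entry, which
      gives \<open>u\<^sub>1 = \<lambda> / k\<close>.\<close>
    have "(\<Sum>w | d x w = 1. E j $ w $ x) = (\<Sum>w | d x w = 1. E j $ y $ z)"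
      using 2 by (intro sum.cong cong) (auto simp: d_commute)
    then have "of_nat (k_val adj) * E j $ y $ z = \<theta> j * E j $ x $ x"
      using adjacency_eigen[OF j, of x x] k by simp
    then show ?thesis using 2 k0 by (simp add: field_simps)
  next
    case (3 i)
    let ?u = "\<lambda>i. poly (u_poly adj i) (\<theta> j)"
    have i: "Suc (Suc i) \<le> D" using 3 d_le by metis
    \<comment> \<open>The eigenvalue equation is read at a pair at distance \<open>i + 1\<close>,
      one less than that of \<open>y\<close> and \<open>z\<close>. The entry at distance
      \<open>i + 2\<close> is then the only one in it that the induction hypothesis does not
      give.\<close>
    then obtain p q where pq: "d p q = Suc i" using ex_pair_at_distance[of "Suc i"] by auto
    let ?C = "\<lambda>h. {w. d p w = 1 \<and> d q w = h}"
    have nb: "{w. d p w = 1} = ?C i \<union> (?C (Suc i) \<union> ?C (Suc (Suc i)))"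
    proof -
      have "d q w = i \<or> d q w = Suc i \<or> d q w = Suc (Suc i)" if "d p w = 1" for w
        using gdist_triangle[OF con, of q w p] gdist_triangle[OF con, of q p w] that pq
          d_commute[of p q] d_commute[of p w] by linarith
      then show ?thesis by auto
    qed
    have e: "E j $ w $ q = ?u h * E j $ x $ x" if "w \<in> ?C h" "h < Suc (Suc i)" for w h
      using less.hyps[of w q] that 3 d_commute[of q w] by simp
    have e2: "E j $ w $ q = E j $ y $ z" if "w \<in> ?C (Suc (Suc i))" for w
      using that 3 d_commute[of q w] by (intro cong) simp
    have num: "card (?C h) = inter_num adj (Suc i) 1 h" if "h \<le> D" for h
      using inter_num_eq[OF dr, of 1 h p q] that diam_pos d_le[of p q] pq by simp
    have "\<theta> j * E j $ p $ q = (\<Sum>w | d p w = 1. E j $ w $ q)"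
      using adjacency_eigen[OF j] by simp
    also have "\<dots> = (\<Sum>w\<in>?C i. E j $ w $ q) + ((\<Sum>w\<in>?C (Suc i). E j $ w $ q)
        + (\<Sum>w\<in>?C (Suc (Suc i)). E j $ w $ q))"
    proof -
      have "?C i \<inter> (?C (Suc i) \<union> ?C (Suc (Suc i))) = {}" "?C (Suc i) \<inter> ?C (Suc (Suc i)) = {}"
        by auto
      then show ?thesis unfolding nb by (simp add: sum.union_disjoint)
    qed
    also have "\<dots> = of_nat (c_num adj (Suc i)) * (?u i * E j $ x $ x)
        + (of_nat (a_num adj (Suc i)) * (?u (Suc i) * E j $ x $ x)
        + of_nat (b_num adj (Suc i)) * E j $ y $ z)"
      using e e2 num i by (simp add: c_num_def a_num_def b_num_def)
    finally have *: "\<theta> j * E j $ p $ q = \<dots>" .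
    have "E j $ p $ q = ?u (Suc i) * E j $ x $ x"
      using less.hyps[of p q] 3 pq by simp
    \<comment> \<open>This allows solving for the unknown entry, as in the defining equation of
      \<open>u_poly\<close>.\<close>
    moreover have "b_num adj (Suc i) \<noteq> 0"
      using b_num_nonzero[OF sym irr con dr] i by simp
    ultimately show ?thesis using * 3 by (simp add: field_simps)
  qed
qed

text \<open>By \<open>E_entry\<close> all \<open>valency i\<close> vertices at distance
  \<open>i\<close> from \<open>x\<close> contribute the same term. The result evaluates the mixed
  inner products in \<open>gram_fg\<close>.\<close>

lemma sphere_sum:
  assumes "i \<le> D" "j \<le> D"
  shows "(A i ** E j) $ x $ x = of_nat (valency i) * poly (u_poly adj i) (\<theta> j) * E j $ x $ x"
proof -
  have "(A i ** E j) $ x $ x = (\<Sum>w | d x w = i. E j $ w $ x)"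
    unfolding matrix_matrix_mult_def vec_lambda_beta
    by (rule sum.mono_neutral_cong_right) (auto simp: dist_mat_def)
  also have "\<dots> = (\<Sum>w | d x w = i. poly (u_poly adj i) (\<theta> j) * E j $ x $ x)"
  proof (rule sum.cong)
    fix w assume "w \<in> {w. d x w = i}"
    then show "E j $ w $ x = poly (u_poly adj i) (\<theta> j) * E j $ x $ x"
      using E_entry[OF assms(2), of w x] d_commute[of w x] by simp
  qed simp
  finally show ?thesis using card_sphere[OF assms(1)] by simp
qed

text \<open>The value is a quotient of two entries of the real matrix \<open>E j\<close>.\<close>

lemma u_cnj:
  assumes "i \<le> D" "j \<le> D"
  shows "cnj (poly (u_poly adj i) (\<theta> j)) = poly (u_poly adj i) (\<theta> j)"
proof -
  obtain y z where "d y z = i" using ex_pair_at_distance[OF assms(1)] by blast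
  then have "poly (u_poly adj i) (\<theta> j) = E j $ y $ z / E j $ x $ x"
    using E_entry[OF assms(2), of y z] assms E_diag_nonzero by simp
  then show ?thesis by (simp add: E_cnj[OF assms(2)])
qed

text \<open>All entries of \<open>E 0\<close> agree, so their ratio is \<open>1\<close>. Hence every
  pair \<open>(i, 0)\<close> is dependent.\<close>

lemma u_at_0:
  assumes "i \<le> D"
  shows "poly (u_poly adj i) (\<theta> 0) = 1"
proof -
  obtain y z where "d y z = i" using ex_pair_at_distance[OF assms(1)] by blast
  moreover have "E 0 = (\<chi> y z. 1 / of_nat CARD('v))"
    using idem by (simp add: primitive_idempotents_def)
  ultimately show ?thesis
    using E_entry[of 0 y z] assms E_diag_nonzero[of 0] by simp
qed

text \<open>Expand \<open>R\<close> in the idempotents: multiplication by \<open>E j\<close> kills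
  every term except the one at \<open>j\<close>.\<close>

lemma bose_mesner_eigen:
  assumes "R \<in> bose_mesner adj" and j: "j \<le> D"
  shows "\<exists>c. R ** E j = cscale c (E j)"
proof -
  have "R \<in> cmat.span (E ` {0..D})"
    using assms idem by (simp add: primitive_idempotents_def)
  then show ?thesis
  proof (induction rule: cmat.span_induct_alt)
    case base
    show ?case by (rule exI[of _ 0]) simp
  next
    case (step c S T)
    obtain t where t: "T ** E j = cscale t (E j)" using step.IH by blast
    obtain i where i: "S = E i" "i \<le> D" using step.hyps by auto
    show ?case
    proof (rule exI[of _ "(if i = j then c else 0) + t"])
      show "(cscale c S + T) ** E j = cscale ((if i = j then c else 0) + t) (E j)"
        using t i j E_mult
        by (simp add: matrix_add_rdistrib mult_cscale_left cmat.scale_left_distrib)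
    qed
  qed
qed

lemma A_in_bose_mesner: "i \<le> D \<Longrightarrow> A i \<in> bose_mesner adj"
  unfolding bose_mesner_def by (intro cmat.span_base) auto

text \<open>\<open>A i ** E j\<close> is a multiple of \<open>E j\<close>, on which
  \<open>E s\<close> acts as the identity or as zero.\<close>

lemma E_A_E:
  assumes "i \<le> D" "j \<le> D" "s \<le> D"
  shows "E s ** (A i ** E j) = (if s = j then A i ** E j else 0)"
proof -
  obtain c where "A i ** E j = cscale c (E j)"
    using bose_mesner_eigen A_in_bose_mesner assms by blast
  then show ?thesis using E_mult assms by (simp add: mult_cscale_right)
qed

section \<open>Inner products of the two families of products\<close>

definition AAs :: "nat \<times> nat \<Rightarrow> complex^'v^'v" where "AAs p = A (fst p) ** As (snd p)"
definition AsA :: "nat \<times> nat \<Rightarrow> complex^'v^'v" where "AsA p = As (snd p) ** A (fst p)"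

lemma AAs_nth: "AAs (i, j) $ y $ z = (if d y z = i then of_nat CARD('v) * E j $ x $ z else 0)"
proof -
  have "AAs (i, j) $ y $ z = (\<Sum>w\<in>UNIV. if w = z then A i $ y $ z * (of_nat CARD('v) * E j $ x $ z) else 0)"
    unfolding AAs_def matrix_matrix_mult_def vec_lambda_beta
    by (rule sum.cong) (auto simp: dual_dist_mat_def)
  then show ?thesis by (simp add: dist_mat_def)
qed

lemma AsA_nth: "AsA (i, j) $ y $ z = (if d y z = i then of_nat CARD('v) * E j $ x $ y else 0)"
proof -
  have "AsA (i, j) $ y $ z = (\<Sum>w\<in>UNIV. if w = y then of_nat CARD('v) * E j $ x $ y * A i $ y $ z else 0)"
    unfolding AsA_def matrix_matrix_mult_def vec_lambda_beta
    by (rule sum.cong) (auto simp: dual_dist_mat_def)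
  then show ?thesis by (simp add: dist_mat_def)
qed

lemma AsA_transpose: "AsA p = transpose (AAs p)"
  by (cases p) (simp add: vec_eq_iff transpose_def AAs_nth AsA_nth d_commute)

definition sqnorm :: "nat \<times> nat \<Rightarrow> complex" where
  "sqnorm p = (of_nat CARD('v))\<^sup>2 * of_nat (valency (fst p)) * E (snd p) $ x $ x"

definition cosine :: "nat \<times> nat \<Rightarrow> complex" where
  "cosine p = poly (u_poly adj (fst p)) (\<theta> (snd p))"

text \<open>Different distances give disjoint supports. For \<open>i = r\<close>, summing over the
  rows \<open>y\<close> first yields a factor \<open>valency i\<close> for each column
  \<open>z\<close>; the remaining sum over \<open>z\<close> is the \<open>(x, x)\<close> entry of
  \<open>E j ** E s\<close>.\<close>

lemma gram_ff:
  assumes "i \<le> D" "j \<le> D" "r \<le> D" "s \<le> D"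
  shows "herm_inner (AAs (i, j)) (AAs (r, s)) = (if (i, j) = (r, s) then sqnorm (i, j) else 0)"
proof (cases "i = r")
  case True
  have eq: "AAs (i, j) $ y $ z * cnj (AAs (r, s) $ y $ z) =
      (if d z y = i then (of_nat CARD('v))\<^sup>2 * (E j $ x $ z * E s $ z $ x) else 0)" for y z
    using True E_cnj[OF assms(4), of x z] E_commute[OF assms(4), of x z] d_commute[of y z]
    by (simp add: AAs_nth power2_eq_square)
  have "herm_inner (AAs (i, j)) (AAs (r, s)) =
      (\<Sum>z\<in>UNIV. \<Sum>y\<in>UNIV. AAs (i, j) $ y $ z * cnj (AAs (r, s) $ y $ z))"
    unfolding herm_inner_sum by (rule sum.swap)
  also have "\<dots> = (\<Sum>z\<in>UNIV. of_nat (valency i) * ((of_nat CARD('v))\<^sup>2 * (E j $ x $ z * E s $ z $ x)))"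
    unfolding eq by (simp add: sum.If_cases card_sphere[OF assms(1)])
  also have "\<dots> = (of_nat CARD('v))\<^sup>2 * of_nat (valency i) * (E j ** E s) $ x $ x"
    by (simp add: matrix_matrix_mult_def sum_distrib_left mult_ac)
  finally show ?thesis using True E_mult assms by (simp add: sqnorm_def)
next
  case False
  then have "AAs (i, j) $ y $ z * cnj (AAs (r, s) $ y $ z) = 0" for y z
    by (simp add: AAs_nth)
  then show ?thesis unfolding herm_inner_sum using False by (simp only: sum.neutral_const) simp
qed

lemma gram_gg:
  assumes "i \<le> D" "j \<le> D" "r \<le> D" "s \<le> D"
  shows "herm_inner (AsA (i, j)) (AsA (r, s)) = (if (i, j) = (r, s) then sqnorm (i, j) else 0)"
  unfolding AsA_transpose herm_inner_transpose using gram_ff[OF assms] .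

text \<open>For \<open>i = r\<close> the double sum is \<open>|X|\<^sup>2\<close> times the
  \<open>(x, x)\<close> entry of \<open>E s ** (A i ** E j)\<close>, which \<open>E_A_E\<close> and
  \<open>sphere_sum\<close> evaluate.\<close>

lemma gram_fg:
  assumes "i \<le> D" "j \<le> D" "r \<le> D" "s \<le> D"
  shows "herm_inner (AAs (i, j)) (AsA (r, s)) = (if (i, j) = (r, s) then cosine (i, j) * sqnorm (i, j) else 0)"
proof (cases "i = r")
  case True
  have eq: "AAs (i, j) $ y $ z * cnj (AsA (r, s) $ y $ z) =
      (of_nat CARD('v))\<^sup>2 * (E s $ x $ y * (A i $ y $ z * E j $ z $ x))" for y z
    using True E_cnj[OF assms(4), of x y] E_commute[OF assms(2), of x z]
    by (simp add: AAs_nth AsA_nth dist_mat_def power2_eq_square)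
  have "herm_inner (AAs (i, j)) (AsA (r, s)) =
      (\<Sum>y\<in>UNIV. \<Sum>z\<in>UNIV. (of_nat CARD('v))\<^sup>2 * (E s $ x $ y * (A i $ y $ z * E j $ z $ x)))"
    unfolding herm_inner_sum eq ..
  also have "\<dots> = (of_nat CARD('v))\<^sup>2 * (E s ** (A i ** E j)) $ x $ x"
    by (simp add: matrix_matrix_mult_def sum_distrib_left)
  also have "\<dots> = (if s = j then cosine (i, j) * sqnorm (i, j) else 0)"
    unfolding E_A_E[OF assms(1,2,4)] using sphere_sum[OF assms(1,2)] by (simp add: sqnorm_def cosine_def)
  finally show ?thesis using True by simp
next
  case False
  then have "AAs (i, j) $ y $ z * cnj (AsA (r, s) $ y $ z) = 0" for y z
    by (simp add: AAs_nth AsA_nth)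
  then show ?thesis unfolding herm_inner_sum using False by (simp only: sum.neutral_const) simp
qed

lemma sqnorm_nonzero: "i \<le> D \<Longrightarrow> j \<le> D \<Longrightarrow> sqnorm (i, j) \<noteq> 0"
  using E_diag_nonzero valency_nonzero by (simp add: sqnorm_def)

lemma sqnorm_cnj: "i \<le> D \<Longrightarrow> j \<le> D \<Longrightarrow> cnj (sqnorm (i, j)) = sqnorm (i, j)"
  by (simp add: sqnorm_def E_cnj)

text \<open>The inner products with the families exchanged follow from \<open>gram_fg\<close> by
  conjugation, since \<open>cosine\<close> and \<open>sqnorm\<close> are real on these
  indices.\<close>

lemma coupled: "coupled_families AAs AsA ({0..D} \<times> {0..D}) sqnorm cosine"
proof
  fix p q assume pq: "p \<in> {0..D} \<times> {0..D}" "q \<in> {0..D} \<times> {0..D}"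
  have "herm_inner (AsA p) (AAs q) = cnj (herm_inner (AAs q) (AsA p))"
    by (rule herm_inner_commute)
  also have "herm_inner (AAs q) (AsA p) = (if q = p then cosine q * sqnorm q else 0)"
    using gram_fg[of "fst q" "snd q" "fst p" "snd p", unfolded prod.collapse] pq
    by (simp add: mem_Times_iff)
  also have "cnj \<dots> = (if p = q then cosine p * sqnorm p else 0)"
    using pq by (auto simp: cosine_def u_cnj sqnorm_cnj)
  finally show "herm_inner (AsA p) (AAs q) = (if p = q then cosine p * sqnorm p else 0)" .
next
  fix p q assume pq: "p \<in> {0..D} \<times> {0..D}" "q \<in> {0..D} \<times> {0..D}"
  show "herm_inner (AAs p) (AAs q) = (if p = q then sqnorm p else 0)"
    using gram_ff[of "fst p" "snd p" "fst q" "snd q", unfolded prod.collapse] pq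
    by (simp add: mem_Times_iff)
  show "herm_inner (AsA p) (AsA q) = (if p = q then sqnorm p else 0)"
    using gram_gg[of "fst p" "snd p" "fst q" "snd q", unfolded prod.collapse] pq
    by (simp add: mem_Times_iff)
  show "herm_inner (AAs p) (AsA q) = (if p = q then cosine p * sqnorm p else 0)"
    using gram_fg[of "fst p" "snd p" "fst q" "snd q", unfolded prod.collapse] pq
    by (simp add: mem_Times_iff)
next
  fix p assume "p \<in> {0..D} \<times> {0..D}"
  then show "sqnorm p \<noteq> 0" using sqnorm_nonzero[of "fst p" "snd p"] by (simp add: mem_Times_iff)
qed simp

section \<open>Dependent index pairs and spanning sets of the algebras\<close>

abbreviation "dep \<equiv> {p \<in> {0..D} \<times> {0..D}. cosine p \<in> {1, -1}}"
abbreviation "indep \<equiv> {p \<in> {0..D} \<times> {0..D}. cosine p \<notin> {1, -1}}"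

text \<open>The map carrying \<open>A i\<close> to \<open>dual_idem adj x i\<close> and \<open>E j\<close> to a multiple of \<open>As j\<close>.\<close>

definition row_diag :: "complex^'v^'v \<Rightarrow> complex^'v^'v" where
  "row_diag R = (\<chi> y z. if y = z then R $ x $ y else 0)"

lemma row_diag_linear:
  "row_diag 0 = 0" "row_diag (cscale t R + S) = cscale t (row_diag R) + row_diag S"
  by (simp_all add: row_diag_def vec_eq_iff)

lemma row_diag_span:
  assumes "R \<in> cmat.span B" and "\<And>S. S \<in> B \<Longrightarrow> row_diag S \<in> cmat.span C"
  shows "row_diag R \<in> cmat.span C"
  using assms(1)
  by (induction rule: cmat.span_induct_alt)
    (auto simp: row_diag_linear cmat.span_zero intro!: cmat.span_add cmat.span_scale assms(2))

lemma row_diag_A: "row_diag (A i) = dual_idem adj x i"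
  by (auto simp: row_diag_def dist_mat_def dual_idem_def vec_eq_iff)

lemma row_diag_E: "cscale (of_nat CARD('v)) (row_diag (E j)) = As j"
  by (auto simp: row_diag_def dual_dist_mat_def vec_eq_iff)

lemma span_E: "cmat.span (E ` {0..D}) = cmat.span (A ` {0..D})"
  using idem by (simp add: primitive_idempotents_def bose_mesner_def)

text \<open>The \<open>A i\<close> and the \<open>E j\<close> span the same space, hence so do their
  images under the linear map \<open>row_diag\<close>, which are the
  \<open>dual_idem adj x i\<close> and nonzero multiples of the \<open>As j\<close>.\<close>

lemma dual_bose_mesner_eq: "dual_bose_mesner adj x = cmat.span (As ` {0..D})"
  unfolding dual_bose_mesner_def
proof (rule equalityI; rule cmat.span_minimal[OF _ cmat.subspace_span]; rule image_subsetI)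
  fix i assume i: "i \<in> {0..D}"
  have "row_diag (A i) \<in> cmat.span (As ` {0..D})"
  proof (rule row_diag_span)
    show "A i \<in> cmat.span (E ` {0..D})"
      unfolding span_E using i by (intro cmat.span_base) auto
    fix S assume "S \<in> E ` {0..D}"
    then obtain j where j: "S = E j" "j \<in> {0..D}" by auto
    have "row_diag (E j) = cscale (1 / of_nat CARD('v)) (As j)"
      unfolding row_diag_E[symmetric] by simp
    then show "row_diag S \<in> cmat.span (As ` {0..D})"
      using j by (simp add: cmat.span_scale cmat.span_base)
  qed
  then show "dual_idem adj x i \<in> cmat.span (As ` {0..D})"
    by (simp add: row_diag_A)
next
  fix j assume j: "j \<in> {0..D}"
  have "row_diag (E j) \<in> cmat.span (dual_idem adj x ` {0..D})"
  proof (rule row_diag_span)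
    show "E j \<in> cmat.span (A ` {0..D})"
      unfolding span_E[symmetric] using j by (intro cmat.span_base) auto
    fix S assume "S \<in> A ` {0..D}"
    then show "row_diag S \<in> cmat.span (dual_idem adj x ` {0..D})"
      using row_diag_A by (auto intro!: cmat.span_base)
  qed
  then show "As j \<in> cmat.span (dual_idem adj x ` {0..D})"
    unfolding row_diag_E[symmetric] by (rule cmat.span_scale)
qed

lemma A_0: "A 0 = mat 1"
  by (auto simp: dist_mat_def mat_def vec_eq_iff d_eq_0)

lemma As_0: "As 0 = mat 1"
proof -
  have "E 0 = (\<chi> y z. 1 / of_nat CARD('v))"
    using idem by (simp add: primitive_idempotents_def)
  then show ?thesis by (simp add: dual_dist_mat_def mat_def vec_eq_iff)
qed

lemma AAs_edge: "AAs (i, 0) = A i" "AAs (0, j) = As j"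
  by (simp_all add: AAs_def A_0 As_0)

text \<open>Members of the dual algebra are diagonal, and members of the Bose-Mesner algebra have
  constant diagonal.\<close>

lemma bose_mesner_Int_dual: "bose_mesner adj \<inter> dual_bose_mesner adj x = cmat.span {mat 1}"
proof (intro equalityI subsetI)
  fix R assume R: "R \<in> bose_mesner adj \<inter> dual_bose_mesner adj x"
  have off: "R $ y $ z = 0" if "y \<noteq> z" for y z
    using R[THEN IntD2] unfolding dual_bose_mesner_def
    by (induction rule: cmat.span_induct_alt) (auto simp: dual_idem_def that)
  have diag: "R $ y $ y = R $ x $ x" for y
    using R bose_mesner_entry_cong[of R y y x x] d_eq_0 by (metis IntD1)
  have "R = cscale (R $ x $ x) (mat 1)"
    using off diag by (auto simp: vec_eq_iff mat_def)
  then show "R \<in> cmat.span {mat 1}"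
    by (metis cmat.span_base cmat.span_scale singletonI)
next
  fix R assume R: "R \<in> cmat.span {mat 1 :: complex^'v^'v}"
  have "A 0 \<in> cmat.span (A ` {0..D})" "As 0 \<in> cmat.span (As ` {0..D})"
    by (rule cmat.span_base, simp)+
  then have "{mat 1} \<subseteq> cmat.span (A ` {0..D})" "{mat 1} \<subseteq> cmat.span (As ` {0..D})"
    by (simp_all add: A_0 As_0)
  then show "R \<in> bose_mesner adj \<inter> dual_bose_mesner adj x"
    using R cmat.span_minimal[OF _ cmat.subspace_span]
    unfolding dual_bose_mesner_eq bose_mesner_def by blast
qed

lemma space_prod_eq:
  "space_prod (bose_mesner adj) (dual_bose_mesner adj x) = cmat.span (AAs ` ({0..D} \<times> {0..D}))"
  "space_prod (dual_bose_mesner adj x) (bose_mesner adj) = cmat.span (AsA ` ({0..D} \<times> {0..D}))"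
  unfolding dual_bose_mesner_eq bose_mesner_def space_prod_span AAs_def[abs_def] AsA_def[abs_def]
  by (simp only: Setcompr_image2, simp only: Setcompr_image2_swap)

text \<open>Any set of index pairs inherits orthogonality. The choices of \<open>K\<close> below are
  the origin, either axis, both axes together, \<open>dep\<close>, and the full square.\<close>

lemma AAs_basis:
  assumes "K \<subseteq> {0..D} \<times> {0..D}"
  shows "orthogonal_basis (AAs ` K) (cmat.span (AAs ` K)) \<and> cmat.dim (cmat.span (AAs ` K)) = card K"
proof -
  have "finite K" using assms finite_subset by auto
  note * = orthogonal_family_basis[of K AAs sqnorm, OF this coupled_families.ff[OF coupled] coupled_families.nz[OF coupled]]
  show ?thesis by (rule conjI; rule *) (use assms in blast)+
qed

lemma AsA_basis:
  "orthogonal_basis (AsA ` ({0..D} \<times> {0..D})) (cmat.span (AsA ` ({0..D} \<times> {0..D})))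
   \<and> cmat.dim (cmat.span (AsA ` ({0..D} \<times> {0..D}))) = card ({0..D} \<times> {0..D})"
  using orthogonal_family_basis[of "{0..D} \<times> {0..D}" AsA sqnorm, OF _ coupled_families.gg[OF coupled] coupled_families.nz[OF coupled]]
  by simp

section \<open>Counting the index pairs\<close>

text \<open>The \<open>2 * D + 1\<close> pairs with a zero coordinate all have cosine
  \<open>1\<close>, by \<open>u\<^sub>0 = 1\<close> and \<open>u_at_0\<close>;
  \<open>P_count\<close> counts the dependent pairs with both coordinates positive.\<close>

lemma card_dep: "card dep = 2 * D + 1 + P_count adj \<theta>"
proof -
  let ?Q = "{(i, j). i \<in> {1..D} \<and> j \<in> {1..D} \<and> poly (u_poly adj i) (\<theta> j) \<in> {1, -1}}"
  have c: "cosine (i, 0) = 1" "cosine (0, j) = 1" if "i \<le> D" for i j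
    using that u_at_0 by (simp_all add: cosine_def)
  have "dep = ({0} \<times> {0..D} \<union> {1..D} \<times> {0}) \<union> ?Q"
  proof (rule set_eqI)
    fix p show "p \<in> dep \<longleftrightarrow> p \<in> ({0} \<times> {0..D} \<union> {1..D} \<times> {0}) \<union> ?Q"
    proof (cases p)
      case (Pair i j)
      show ?thesis
      proof (cases "i = 0 \<or> j = 0")
        case True
        then show ?thesis using Pair c by auto
      next
        case False
        then show ?thesis using Pair by (auto simp: cosine_def)
      qed
    qed
  qed
  moreover have "card (({0} \<times> {0..D} \<union> {1..D} \<times> {0}) \<union> ?Q)
      = card ({0} \<times> {0..D} \<union> {1..D} \<times> {0::nat}) + card ?Q"
  proof (rule card_Un_disjoint)
    show "finite ?Q" by (rule finite_subset[of _ "{1..D} \<times> {1..D}"]) auto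
  qed auto
  moreover have "card ({0} \<times> {0..D} \<union> {1..D} \<times> {0::nat}) = card ({0::nat} \<times> {0..D}) + card ({1..D} \<times> {0::nat})"
    by (rule card_Un_disjoint) auto
  ultimately show ?thesis by (simp add: P_count_def card_cartesian_product)
qed

lemma card_indep: "card indep + card dep = (D + 1)\<^sup>2"
proof -
  have "card (indep \<union> dep) = card indep + card dep"
    by (intro card_Un_disjoint) auto
  moreover have "indep \<union> dep = {0..D} \<times> {0..D}" by blast
  ultimately show ?thesis by (simp add: card_cartesian_product power2_eq_square)
qed

lemma product_sets:
  "{A i ** As j |i j. i \<le> D \<and> j \<le> D} = AAs ` ({0..D} \<times> {0..D})"
  "{As j ** A i |i j. i \<le> D \<and> j \<le> D} = AsA ` ({0..D} \<times> {0..D})"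
  "{A i ** As j |i j. i \<le> D \<and> j \<le> D \<and> poly (u_poly adj i) (\<theta> j) \<in> {1, -1}} = AAs ` dep"
  "{A i ** As j + As j ** A i |i j. i \<le> D \<and> j \<le> D \<and> poly (u_poly adj i) (\<theta> j) \<notin> {1, -1}}
    = (\<lambda>p. AAs p + AsA p) ` indep"
  "{A i ** As j - As j ** A i |i j. i \<le> D \<and> j \<le> D \<and> poly (u_poly adj i) (\<theta> j) \<notin> {1, -1}}
    = (\<lambda>p. AAs p - AsA p) ` indep"
  unfolding AAs_def AsA_def cosine_def by (rule Setcompr_pair_image Setcompr_pair_image_all)+

section \<open>Orthogonal bases and dimensions of the eight spaces\<close>

abbreviation "M \<equiv> bose_mesner adj"
abbreviation "Ms \<equiv> dual_bose_mesner adj x"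

lemma Int_basis: "orthogonal_basis {mat 1} (M \<inter> Ms) \<and> cmat.dim (M \<inter> Ms) = 1"
  using AAs_basis[of "{(0, 0)}"] unfolding bose_mesner_Int_dual by (simp add: AAs_edge A_0)

lemma bose_mesner_basis: "orthogonal_basis (A ` {0..D}) M \<and> cmat.dim M = D + 1"
proof -
  have "AAs ` ((\<lambda>i. (i, 0)) ` {0..D}) = A ` {0..D}"
    by (simp only: image_image AAs_edge)
  moreover have "card ((\<lambda>i. (i, 0::nat)) ` {0..D}) = D + 1"
    by (subst card_image) (simp_all add: inj_on_def)
  moreover have "(\<lambda>i. (i, 0)) ` {0..D} \<subseteq> {0..D} \<times> {0..D}"
    by auto
  ultimately show ?thesis
    using AAs_basis unfolding bose_mesner_def by metis
qed

lemma dual_bose_mesner_basis: "orthogonal_basis (As ` {0..D}) Ms \<and> cmat.dim Ms = D + 1"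
proof -
  have "AAs ` ((\<lambda>j. (0, j)) ` {0..D}) = As ` {0..D}"
    by (simp only: image_image AAs_edge)
  moreover have "card ((\<lambda>j. (0::nat, j)) ` {0..D}) = D + 1"
    by (subst card_image) (simp_all add: inj_on_def)
  moreover have "(\<lambda>j. (0, j)) ` {0..D} \<subseteq> {0..D} \<times> {0..D}"
    by auto
  ultimately show ?thesis
    using AAs_basis unfolding dual_bose_mesner_eq by metis
qed

lemma plus_basis:
  "orthogonal_basis (A ` {1..D} \<union> {mat 1} \<union> As ` {1..D}) (M + Ms) \<and> cmat.dim (M + Ms) = 2 * D + 1"
proof -
  \<comment> \<open>Both axes of the index square. The origin is listed once, since
    \<open>A 0\<close> and \<open>As 0\<close> are both the identity matrix.\<close>
  let ?K = "(\<lambda>i. (i, 0)) ` {1..D} \<union> {(0, 0)} \<union> (\<lambda>j. (0, j)) ` {1..D}"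
  have img: "AAs ` ?K = A ` {1..D} \<union> {mat 1} \<union> As ` {1..D}"
    by (simp only: image_Un image_image image_insert image_empty AAs_edge A_0)
  have split: "{0..D} = insert 0 {1..D}" by auto
  have "A ` {0..D} \<union> As ` {0..D} = A ` {1..D} \<union> {mat 1} \<union> As ` {1..D}"
    unfolding split image_insert A_0 As_0 by blast
  then have "M + Ms = cmat.span (AAs ` ?K)"
    unfolding img dual_bose_mesner_eq bose_mesner_def span_plus_span by simp
  moreover have "card ?K = 2 * D + 1"
  proof -
    have "card ?K = card ((\<lambda>i. (i, 0::nat)) ` {1..D} \<union> {(0, 0)}) + card ((\<lambda>j. (0::nat, j)) ` {1..D})"
      by (rule card_Un_disjoint) auto
    also have "card ((\<lambda>i. (i, 0::nat)) ` {1..D} \<union> {(0, 0)}) = card ((\<lambda>i. (i, 0::nat)) ` {1..D}) + 1"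
      by (subst card_Un_disjoint) auto
    finally show ?thesis by (simp add: card_image inj_on_def)
  qed
  moreover have "?K \<subseteq> {0..D} \<times> {0..D}" by auto
  ultimately show ?thesis
    using AAs_basis[of ?K] unfolding img by simp
qed

lemma prod_Int_basis:
  "orthogonal_basis {A i ** As j |i j. i \<le> D \<and> j \<le> D \<and> poly (u_poly adj i) (\<theta> j) \<in> {1, -1}}
     (space_prod M Ms \<inter> space_prod Ms M)
   \<and> cmat.dim (space_prod M Ms \<inter> space_prod Ms M) = 2 * D + 1 + P_count adj \<theta>"
proof -
  have "dep \<subseteq> {0..D} \<times> {0..D}" by blast
  from AAs_basis[OF this] show ?thesis
    unfolding space_prod_eq coupled_families.span_Int[OF coupled] product_sets card_dep .
qed

lemma prod_basis:
  "orthogonal_basis {A i ** As j |i j. i \<le> D \<and> j \<le> D} (space_prod M Ms)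
   \<and> cmat.dim (space_prod M Ms) = (D + 1)^2"
  unfolding space_prod_eq product_sets
  using AAs_basis[OF order_refl] by (simp add: card_cartesian_product power2_eq_square)

lemma prod_swap_basis:
  "orthogonal_basis {As j ** A i |i j. i \<le> D \<and> j \<le> D} (space_prod Ms M)
   \<and> cmat.dim (space_prod Ms M) = (D + 1)^2"
  unfolding space_prod_eq product_sets
  using AsA_basis by (simp add: card_cartesian_product power2_eq_square)

lemma prod_plus_basis:
  "orthogonal_basis
     ({A i ** As j + As j ** A i |i j. i \<le> D \<and> j \<le> D \<and> poly (u_poly adj i) (\<theta> j) \<notin> {1, -1}}
      \<union> {A i ** As j - As j ** A i |i j. i \<le> D \<and> j \<le> D \<and> poly (u_poly adj i) (\<theta> j) \<notin> {1, -1}}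
      \<union> {A i ** As j |i j. i \<le> D \<and> j \<le> D \<and> poly (u_poly adj i) (\<theta> j) \<in> {1, -1}})
     (space_prod M Ms + space_prod Ms M)
   \<and> int (cmat.dim (space_prod M Ms + space_prod Ms M))
       = 2 * int D ^ 2 + 2 * int D + 1 - int (P_count adj \<theta>)"
  unfolding space_prod_eq span_plus_span product_sets
proof
  note * = coupled_families.sum_family_basis[OF coupled]
  let ?V = "cmat.span (AAs ` ({0..D} \<times> {0..D}) \<union> AsA ` ({0..D} \<times> {0..D}))"
  show "orthogonal_basis ((\<lambda>p. AAs p + AsA p) ` indep \<union> (\<lambda>p. AAs p - AsA p) ` indep \<union> AAs ` dep) ?V"
    by (rule *(1))
  \<comment> \<open>The dimension is \<open>2 * card indep + card dep\<close>. Adding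
    \<open>card dep\<close> completes it to twice the size of the index square and avoids
    subtraction of natural numbers.\<close>
  have "cmat.dim ?V + card dep = 2 * (card indep + card dep)"
    unfolding *(2) by simp
  then have "cmat.dim ?V + (2 * D + 1 + P_count adj \<theta>) = 2 * (D + 1)\<^sup>2"
    unfolding card_indep unfolding card_dep .
  then have "int (cmat.dim ?V) + (2 * int D + 1 + int (P_count adj \<theta>)) = 2 * (int D + 1)\<^sup>2"
    by (metis (mono_tags) of_nat_add of_nat_mult of_nat_power of_nat_1 of_nat_numeral)
  then show "int (cmat.dim ?V) = 2 * int D ^ 2 + 2 * int D + 1 - int (P_count adj \<theta>)"
    by (simp add: power2_eq_square algebra_simps)
qed

end

theorem theorem6p1:
  fixes adj :: "'v::finite \<Rightarrow> 'v \<Rightarrow> bool"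
    and x :: 'v
    and E :: "nat \<Rightarrow> complex^'v^'v"
    and \<theta> :: "nat \<Rightarrow> complex"
    and D P :: nat
    and M Ms :: "(complex^'v^'v) set"
    and A As :: "nat \<Rightarrow> complex^'v^'v"
    and u :: "nat \<Rightarrow> complex poly"
  assumes "symp adj" and "irreflp adj" and "\<forall>y z. adj\<^sup>*\<^sup>* y z"
    and "distance_regular adj"
    and D: "D = gdiam adj" and "3 \<le> D"
    and A: "A = dist_mat adj"
    and "primitive_idempotents adj E"
    and "\<forall>i\<le>D. A 1 ** E i = cscale (\<theta> i) (E i)"
    and M: "M = bose_mesner adj"
    and Ms: "Ms = dual_bose_mesner adj x"
    and As: "As = dual_dist_mat E x"
    and u: "u = u_poly adj"
    and P: "P = P_count adj \<theta>"
  shows "(orthogonal_basis {mat 1} (M \<inter> Ms) \<and> cmat.dim (M \<inter> Ms) = 1)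
    \<and> (orthogonal_basis (A ` {0..D}) M \<and> cmat.dim M = D + 1)
    \<and> (orthogonal_basis (As ` {0..D}) Ms \<and> cmat.dim Ms = D + 1)
    \<and> (orthogonal_basis (A ` {1..D} \<union> {mat 1} \<union> As ` {1..D}) (M + Ms)
       \<and> cmat.dim (M + Ms) = 2 * D + 1)
    \<and> (orthogonal_basis
         {A i ** As j |i j. i \<le> D \<and> j \<le> D \<and> poly (u i) (\<theta> j) \<in> {1, -1}}
         (space_prod M Ms \<inter> space_prod Ms M)
       \<and> cmat.dim (space_prod M Ms \<inter> space_prod Ms M) = 2 * D + 1 + P)
    \<and> (orthogonal_basis {A i ** As j |i j. i \<le> D \<and> j \<le> D} (space_prod M Ms)
       \<and> cmat.dim (space_prod M Ms) = (D + 1)^2)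
    \<and> (orthogonal_basis {As j ** A i |i j. i \<le> D \<and> j \<le> D} (space_prod Ms M)
       \<and> cmat.dim (space_prod Ms M) = (D + 1)^2)
    \<and> (orthogonal_basis
         ({A i ** As j + As j ** A i |i j. i \<le> D \<and> j \<le> D \<and> poly (u i) (\<theta> j) \<notin> {1, -1}}
          \<union> {A i ** As j - As j ** A i |i j. i \<le> D \<and> j \<le> D \<and> poly (u i) (\<theta> j) \<notin> {1, -1}}
          \<union> {A i ** As j |i j. i \<le> D \<and> j \<le> D \<and> poly (u i) (\<theta> j) \<in> {1, -1}})
         (space_prod M Ms + space_prod Ms M)
       \<and> int (cmat.dim (space_prod M Ms + space_prod Ms M))
           = 2 * int D ^ 2 + 2 * int D + 1 - int P)"
proof -
  have "drg adj E \<theta>"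
  proof (rule drg.intro)
    show "1 \<le> gdiam adj" using \<open>3 \<le> D\<close> D by simp
    show "\<forall>i\<le>gdiam adj. dist_mat adj 1 ** E i = cscale (\<theta> i) (E i)"
      using assms(9) unfolding D A .
  qed (fact assms)+
  then interpret drg adj x E \<theta> .
  show ?thesis
    unfolding D A M Ms As u P
    by (intro conjI[OF Int_basis] conjI[OF bose_mesner_basis] conjI[OF dual_bose_mesner_basis]
        conjI[OF plus_basis] conjI[OF prod_Int_basis] conjI[OF prod_basis] conjI[OF prod_swap_basis]
        prod_plus_basis)
qed

end
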